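(* Let $r\ge 2$ and $s,t\ge 2r$ be integers. Then for every positive integer $n$ there exists a red/blue edge-coloring of the Kneser graph $\mathrm{KG}(n,r)$ containing no red induced $\mathrm{KG}(s,r)$ and no blue induced $\mathrm{KG}(t,r)$. In other words, the induced $r$-Kneser Ramsey number $IR^{\mathrm{KG}}_r(s,t)$ does not exist.
   Context: The Kneser graph $\mathrm{KG}(n,r)$ has vertex set the $r$-element subsets of $[n]=\{1,\dots,n\}$, with two sets adjacent iff they are disjoint. An induced $\mathrm{KG}(s,r)$ in $\mathrm{KG}(n,r)$ is the subgraph induced on $\binom{S}{r}$ (all $r$-subsets of $S$) for some $S\subseteq[n]$ with $|S|=s$; it is red (resp. blue) if all of its edges are red (resp. blue). The induced $r$-Kneser Ramsey number $IR^{\mathrm{KG}}_r(s,t)$ is the minimum $n$, if it exists, such that every red/blue edge-coloring of $\mathrm{KG}(n,r)$ contains a red induced $\mathrm{KG}(s,r)$ or a blue induced $\mathrm{KG}(t,r)$. *)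

theory Defs
  imports "HOL-Library.Ramsey"
begin

text \<open>
  A simple graph is given by its vertex set and its set of edges, an edge being
  the unordered pair of its endpoints. The set of \<open>r\<close>-element subsets of \<open>A\<close> is
  \<open>[A]\<^bsup>r\<^esup>\<close>, i.e. \<open>nsets A r\<close>.
\<close>

type_synonym 'a sgraph = "'a set \<times> 'a set set"

abbreviation sverts :: "'a sgraph \<Rightarrow> 'a set" where
  "sverts G \<equiv> fst G"

abbreviation sedges :: "'a sgraph \<Rightarrow> 'a set set" where
  "sedges G \<equiv> snd G"

definition induced_sgraph :: "'a sgraph \<Rightarrow> 'a set \<Rightarrow> 'a sgraph" where
  "induced_sgraph G U = (sverts G \<inter> U, {e \<in> sedges G. e \<subseteq> U})"

text \<open>
  The condition \<open>A \<noteq> B\<close> only matters for \<open>r = 0\<close>, where it excludes a loop at the empty set.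
\<close>

definition KG :: "nat \<Rightarrow> nat \<Rightarrow> nat set sgraph" where
  "KG n r = ([{1..n}]\<^bsup>r\<^esup>,
             {{A, B} | A B. A \<in> [{1..n}]\<^bsup>r\<^esup> \<and> B \<in> [{1..n}]\<^bsup>r\<^esup> \<and> A \<noteq> B \<and> A \<inter> B = {}})"

datatype colour = Red | Blue

text \<open>
  An edge-colouring is a function on all sets of vertices; only its values on the edges of the
  graph in question are ever used.
\<close>

type_synonym 'a edge_colouring = "'a set \<Rightarrow> colour"

definition monochromatic :: "'a edge_colouring \<Rightarrow> colour \<Rightarrow> 'a sgraph \<Rightarrow> bool" where
  "monochromatic c k H \<longleftrightarrow> (\<forall>e \<in> sedges H. c e = k)"

definition has_mono_induced_KG ::
    "nat \<Rightarrow> nat \<Rightarrow> nat set edge_colouring \<Rightarrow> colour \<Rightarrow> nat \<Rightarrow> bool" where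
  "has_mono_induced_KG n r c k s \<longleftrightarrow>
     (\<exists>S. S \<subseteq> {1..n} \<and> card S = s \<and> monochromatic c k (induced_sgraph (KG n r) ([S]\<^bsup>r\<^esup>)))"

definition KG_arrows :: "nat \<Rightarrow> nat \<Rightarrow> nat \<Rightarrow> nat \<Rightarrow> bool" where
  "KG_arrows n r s t \<longleftrightarrow>
     (\<forall>c. has_mono_induced_KG n r c Red s \<or> has_mono_induced_KG n r c Blue t)"

text \<open>The induced Kneser Ramsey number; \<open>None\<close> means that it does not exist.\<close>

definition IR_KG :: "nat \<Rightarrow> nat \<Rightarrow> nat \<Rightarrow> nat option" where
  "IR_KG r s t =
     (if \<exists>n\<ge>1. KG_arrows n r s t then Some (LEAST n. 1 \<le> n \<and> KG_arrows n r s t) else None)"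

end

theory Submission
  imports Defs
begin

text \<open>
  Colour an edge \<open>{A, B}\<close> red iff one of the sets lies entirely below the other. Every \<open>S\<close>
  with at least \<open>2r\<close> elements contains \<open>r\<close>-sets \<open>L\<close> below \<open>U\<close>, a red edge; exchanging one element
  of \<open>L\<close> with one of \<open>U\<close> interleaves the two sets (as \<open>r \<ge> 2\<close>) and gives a blue edge.
\<close>

definition below :: "'a::linorder set \<Rightarrow> 'a set \<Rightarrow> bool" where
  "below A B \<longleftrightarrow> (\<forall>a\<in>A. \<forall>b\<in>B. a < b)"

text \<open>An edge is an unordered pair, so the existential tries both orders of its
  endpoints.\<close>

definition separation_colouring :: "'a::linorder set edge_colouring" where
  "separation_colouring e = (if \<exists>A B. e = {A, B} \<and> below A B then Red else Blue)"

lemma separation_colouring_pair: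
  "separation_colouring {A, B} = (if below A B \<or> below B A then Red else Blue)"
  unfolding separation_colouring_def by (auto simp: doubleton_eq_iff)

lemma below_disjoint: "below A B \<Longrightarrow> A \<inter> B = {}"
  unfolding below_def by force

text \<open>Cut the increasing enumeration of \<open>S\<close> after \<open>j\<close> entries and
  take the next \<open>k\<close>.\<close>

lemma obtain_below_nsets:
  fixes S :: "'a::linorder set"
  assumes "finite S" "j + k \<le> card S"
  obtains L U where "L \<in> [S]\<^bsup>j\<^esup>" "U \<in> [S]\<^bsup>k\<^esup>" "below L U"
proof -
  let ?xs = "sorted_list_of_set S"
  let ?L = "set (take j ?xs)" and ?U = "set (take k (drop j ?xs))"
  have "sorted_wrt (<) (take j ?xs @ drop j ?xs)"
    by simp
  then have "below ?L ?U"
    unfolding sorted_wrt_append below_def by (blast dest: in_set_takeD)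
  moreover have "?L \<subseteq> S" "?U \<subseteq> S"
    using assms(1) by (auto dest!: in_set_takeD in_set_dropD)
  moreover have "card ?L = j" "card ?U = k"
    using assms by (simp_all add: distinct_card)
  ultimately show thesis
    using that[of ?L ?U] by (simp add: nsets_def)
qed

text \<open>The swapped elements refute the first order, because \<open>l < u\<close>; the elements
  left in place refute the second, because \<open>l' < u'\<close>.\<close>

lemma exchange_not_below:
  assumes "below L U" "l \<in> L" "l' \<in> L" "l' \<noteq> l" "u \<in> U" "u' \<in> U" "u' \<noteq> u"
  shows "\<not> below (insert u (L - {l})) (insert l (U - {u}))"
    and "\<not> below (insert l (U - {u})) (insert u (L - {l}))"
  using assms unfolding below_def by (blast dest: order_less_asym)+

lemma not_monochromaticI:
  assumes "S \<subseteq> {1..n}" "A \<in> [S]\<^bsup>r\<^esup>" "B \<in> [S]\<^bsup>r\<^esup>" "A \<inter> B = {}" "r > 0" "c {A, B} \<noteq> k"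
  shows "\<not> monochromatic c k (induced_sgraph (KG n r) ([S]\<^bsup>r\<^esup>))"
proof -
  \<comment> \<open>Equal disjoint sets would be empty, against \<open>r > 0\<close>.\<close>
  have "A \<noteq> B"
    using assms(2,4,5) by (auto simp: nsets_def)
  moreover have "A \<in> [{1..n}]\<^bsup>r\<^esup>" "B \<in> [{1..n}]\<^bsup>r\<^esup>"
    using assms(1-3) by (auto simp: nsets_def)
  ultimately have "{A, B} \<in> sedges (induced_sgraph (KG n r) ([S]\<^bsup>r\<^esup>))"
    using assms(2-4) unfolding induced_sgraph_def KG_def by auto
  then show ?thesis
    using assms(6) unfolding monochromatic_def by blast
qed

text \<open>The colour \<open>k\<close> is arbitrary, so that one lemma serves both red with
  \<open>s\<close> and blue with \<open>t\<close>.\<close>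

lemma separation_colouring_no_mono:
  assumes r: "r \<ge> 2" and s: "s \<ge> 2 * r"
  shows "\<not> has_mono_induced_KG n r separation_colouring k s"
  unfolding has_mono_induced_KG_def
proof (intro notI, elim exE conjE)
  fix S assume S: "S \<subseteq> {1..n}" "card S = s"
    and mono: "monochromatic separation_colouring k (induced_sgraph (KG n r) ([S]\<^bsup>r\<^esup>))"
  have "finite S"
    using S(1) finite_subset by blast
  then obtain L U where L: "L \<in> [S]\<^bsup>r\<^esup>" and U: "U \<in> [S]\<^bsup>r\<^esup>" and LU: "below L U"
    using obtain_below_nsets[of S r r] s S(2) by auto
  have disj: "L \<inter> U = {}"
    using LU by (rule below_disjoint)
  have fin: "finite L" "finite U" and card: "card L = r" "card U = r"
    using L U by (auto simp: nsets_def)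
  \<comment> \<open>Here \<open>r \<ge> 2\<close> enters: besides the element to be exchanged,
    another one must stay behind.\<close>
  obtain l l' where l: "l \<in> L" "l' \<in> L" "l' \<noteq> l"
    using card(1) r card_le_Suc0_iff_eq[OF fin(1)] by fastforce
  obtain u u' where u: "u \<in> U" "u' \<in> U" "u' \<noteq> u"
    using card(2) r card_le_Suc0_iff_eq[OF fin(2)] by fastforce
  let ?A = "insert u (L - {l})" and ?B = "insert l (U - {u})"
  \<comment> \<open>Each inserted element is new to its set, so the exchange preserves the size
    \<open>r\<close>.\<close>
  have "u \<notin> L" "l \<notin> U"
    using disj l u by auto
  then have "?A \<in> [S]\<^bsup>r\<^esup>" "?B \<in> [S]\<^bsup>r\<^esup>" "?A \<inter> ?B = {}"
    using L U l(1) u(1) r disj by (auto simp: nsets_def)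
  moreover have "separation_colouring {?A, ?B} = Blue"
    using exchange_not_below[OF LU l u] by (simp add: separation_colouring_pair)
  moreover have "separation_colouring {L, U} = Red"
    using LU by (simp add: separation_colouring_pair)
  \<comment> \<open>The blue edge \<open>{?A, ?B}\<close> excludes \<open>k = Red\<close>, and the
    red edge \<open>{L, U}\<close> excludes \<open>k = Blue\<close>.\<close>
  ultimately show False
    using mono not_monochromaticI[OF S(1) L U disj, of separation_colouring k]
      not_monochromaticI[OF S(1), of ?A r ?B separation_colouring k] r
    by (cases k) auto
qed

theorem theorem4p1:
  fixes r s t :: nat
  assumes "r \<ge> 2" and "s \<ge> 2 * r" and "t \<ge> 2 * r"
  shows "(\<forall>n\<ge>1. \<exists>c :: nat set edge_colouring.
            \<not> has_mono_induced_KG n r c Red s \<and> \<not> has_mono_induced_KG n r c Blue t)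
         \<and> IR_KG r s t = None"
  \<comment> \<open>The same colouring refutes \<open>KG_arrows n r s t\<close> for every
    \<open>n\<close>, so \<open>IR_KG\<close> takes its \<open>None\<close> branch.\<close>
  using separation_colouring_no_mono[OF assms(1,2)] separation_colouring_no_mono[OF assms(1,3)]
  unfolding IR_KG_def KG_arrows_def by (smt (verit, best))

end
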